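(* Let $J:(0,\infty)\to\mathbb{R}$ be continuous and non-constant. Assume that for all $x,y>0$, $$J(xy)+J(x/y)=2J(x)+2J(y)+2J(x)J(y),$$ and that the function $J_{\log}:\mathbb{R}\to\mathbb{R}$, $J_{\log}(t):=J(e^t)$, is twice differentiable at $t=0$ with $J_{\log}''(0)=1$. Then for all $x>0$, $$J(x)=\tfrac12\bigl(x+x^{-1}\bigr)-1=\frac{(x-1)^2}{2x}.$$
   Context: The displayed functional equation is called the Recognition Composition Law (RCL). *)

theory Defs
  imports "HOL-Analysis.Analysis"
begin

text \<open>
  A function on the open half-line is a total function \<open>real \<Rightarrow> real\<close> of which only the
  values on \<open>{0<..}\<close> are ever used.
\<close>

definition recognition_composition_law :: "(real \<Rightarrow> real) \<Rightarrow> bool" where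
  "recognition_composition_law J \<longleftrightarrow>
     (\<forall>x>0. \<forall>y>0. J (x * y) + J (x / y) = 2 * J x + 2 * J y + 2 * J x * J y)"

definition J_log :: "(real \<Rightarrow> real) \<Rightarrow> real \<Rightarrow> real" where
  "J_log J t = J (exp t)"

text \<open>
  Being twice differentiable at a point includes differentiability in a neighbourhood of it.
  This has to be required explicitly, because \<^const>\<open>deriv\<close> is total and has an
  arbitrary value where the derivative does not exist.
\<close>

definition twice_differentiable_at :: "(real \<Rightarrow> real) \<Rightarrow> real \<Rightarrow> bool" where
  "twice_differentiable_at f a \<longleftrightarrow>
     (\<forall>\<^sub>F t in nhds a. f differentiable (at t)) \<and> deriv f differentiable (at a)"

end

theory Submission
  imports Defs
begin

text \<open>
  The function \<open>H t = 1 + J (exp t)\<close> satisfies d'Alembert's equation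
  \<open>H (t + u) + H (t - u) = 2 * H t * H u\<close>, and the claim is that \<open>H = cosh\<close>. Since \<open>J\<close> is
  non-constant, \<open>H 0 = 1\<close>; hence \<open>H\<close> is even, \<open>H\<close> has derivative \<open>0\<close> at \<open>0\<close>, and
  \<open>H s = 1 + s\<^sup>2 / 2 + o(s\<^sup>2)\<close> by Taylor's theorem (lemma \<open>taylor_peano_2\<close>). The same
  holds for \<open>cosh\<close>.

  The case \<open>t = u\<close> of d'Alembert's equation is the doubling formula
  \<open>H (2 * s) = 2 * (H s)\<^sup>2 - 1\<close>, which computes \<open>H t\<close> from the values \<open>H (t / 2 ^ n)\<close>
  arbitrarily close to \<open>0\<close>. One doubling multiplies the difference of two solutions by a factor
  close to \<open>4\<close>, so \<open>n\<close> doublings multiply it by \<open>O(4 ^ n)\<close>; if the solutions have the same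
  expansion to second order, then their difference at \<open>t / 2 ^ n\<close> is \<open>o(1 / 4 ^ n)\<close>, and they
  agree (lemma \<open>doubling_formula_unique\<close>).
\<close>

text \<open>
  Differentiability near \<open>0\<close> is what makes L'Hopital's rule applicable; after one application the
  quotient is the difference quotient of \<open>deriv f\<close> at \<open>0\<close>.
\<close>
lemma taylor_peano_2:
  fixes f :: "real \<Rightarrow> real"
  assumes "twice_differentiable_at f 0"
  shows "((\<lambda>t. (f t - f 0 - deriv f 0 * t) / t\<^sup>2) \<longlongrightarrow> deriv (deriv f) 0 / 2) (at 0)"
proof (rule lhopital)
  have ev: "\<forall>\<^sub>F t in nhds 0. (f has_real_derivative deriv f t) (at t)"
    using assms unfolding twice_differentiable_at_def
    by (auto elim!: eventually_mono simp: DERIV_deriv_iff_real_differentiable)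
  have "isCont f 0"
    using eventually_nhds_x_imp_x[OF ev] DERIV_isCont by blast
  then have "((\<lambda>t. f t - f 0 - deriv f 0 * t) \<longlongrightarrow> f 0 - f 0 - deriv f 0 * 0) (at 0)"
    by (intro tendsto_intros) (simp add: isCont_def)
  then show "((\<lambda>t. f t - f 0 - deriv f 0 * t) \<longlongrightarrow> 0) (at 0)"
    by simp
  show "((\<lambda>t::real. t\<^sup>2) \<longlongrightarrow> 0) (at 0)"
    by (auto intro!: tendsto_eq_intros)
  show "\<forall>\<^sub>F t::real in at 0. t\<^sup>2 \<noteq> 0" "\<forall>\<^sub>F t::real in at 0. 2 * t \<noteq> 0"
    by (auto simp: eventually_at_filter)
  show "\<forall>\<^sub>F t in at 0. ((\<lambda>t. f t - f 0 - deriv f 0 * t) has_real_derivative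
      deriv f t - deriv f 0) (at t)"
    using ev by (auto simp: eventually_at_filter elim!: eventually_mono intro!: derivative_eq_intros)
  show "\<forall>\<^sub>F t::real in at 0. ((\<lambda>t. t\<^sup>2) has_real_derivative 2 * t) (at t)"
    by (auto intro!: always_eventually derivative_eq_intros)
  have "(deriv f has_real_derivative deriv (deriv f) 0) (at 0)"
    using assms by (simp add: twice_differentiable_at_def DERIV_deriv_iff_real_differentiable)
  then have "((\<lambda>t. (deriv f t - deriv f 0) / t / 2) \<longlongrightarrow> deriv (deriv f) 0 / 2) (at 0)"
    by (intro tendsto_intros) (simp_all add: has_field_derivative_iff)
  then show "((\<lambda>t. (deriv f t - deriv f 0) / (2 * t)) \<longlongrightarrow> deriv (deriv f) 0 / 2) (at 0)"
    by (simp add: mult.commute)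
qed

lemma deriv_even_0:
  fixes f :: "real \<Rightarrow> real"
  assumes "f differentiable (at 0)" and "\<And>t. f (- t) = f t"
  shows "deriv f 0 = 0"
proof -
  have d: "(f has_real_derivative deriv f 0) (at 0)"
    using assms(1) by (simp add: DERIV_deriv_iff_real_differentiable)
  then have "((\<lambda>t. f (- t)) has_real_derivative - deriv f 0) (at 0)"
    using DERIV_mirror[of f "deriv f 0" 0] by simp
  then have "deriv f 0 = - deriv f 0"
    by (intro DERIV_unique[OF d]) (simp add: assms(2))
  then show ?thesis by simp
qed

lemma eventually_abs_le_quadratic:
  fixes f :: "real \<Rightarrow> real"
  assumes "((\<lambda>s. (f s - 1) / s\<^sup>2) \<longlongrightarrow> c) (at 0)"
  shows "\<forall>\<^sub>F s in at 0. \<bar>f s\<bar> \<le> 1 + (\<bar>c\<bar> + 1) * s\<^sup>2"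
proof -
  have "\<forall>\<^sub>F s in at 0. \<bar>(f s - 1) / s\<^sup>2\<bar> < \<bar>c\<bar> + 1"
    by (rule order_tendstoD(2)[OF tendsto_rabs[OF assms]]) simp
  moreover have "\<forall>\<^sub>F s::real in at 0. s \<noteq> 0"
    by (simp add: eventually_at_filter)
  ultimately show ?thesis
  proof eventually_elim
    case (elim s)
    then have "\<bar>f s - 1\<bar> < (\<bar>c\<bar> + 1) * s\<^sup>2"
      by (simp add: abs_divide pos_divide_less_eq)
    then show ?case by linarith
  qed
qed

text \<open>
  The quotient \<open>(f - g) (2 * s) / (f - g) s = 2 * (f s + g s)\<close> has absolute value at most
  \<open>4 * exp (K * s\<^sup>2)\<close> for small \<open>s\<close>. The weight \<open>exp (- K * s\<^sup>2 / 3)\<close> absorbs the exponential, because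
  \<open>(2 * s)\<^sup>2 - s\<^sup>2 = 3 * s\<^sup>2\<close>: the weighted difference grows by at most the factor \<open>4\<close>, while
  \<open>s\<^sup>2\<close> grows by exactly this factor. Hence the weighted difference divided by \<open>s\<^sup>2\<close>
  does not decrease under halving, although it tends to \<open>0\<close>; so it vanishes.
\<close>
lemma doubling_formula_unique:
  fixes f g :: "real \<Rightarrow> real"
  assumes f: "\<And>s. f (2 * s) = 2 * (f s)\<^sup>2 - 1" and g: "\<And>s. g (2 * s) = 2 * (g s)\<^sup>2 - 1"
    and f_lim: "((\<lambda>s. (f s - 1) / s\<^sup>2) \<longlongrightarrow> c) (at 0)"
    and g_lim: "((\<lambda>s. (g s - 1) / s\<^sup>2) \<longlongrightarrow> c) (at 0)"
    and "t \<noteq> 0"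
  shows "f t = g t"
proof -
  define K where "K = \<bar>c\<bar> + 1"
  define Q where "Q s = \<bar>f s - g s\<bar> * exp (- K * s\<^sup>2 / 3) / s\<^sup>2" for s
  have diff: "f (2 * s) - g (2 * s) = 2 * (f s + g s) * (f s - g s)" for s
    unfolding f g by (simp add: algebra_simps power2_eq_square)
  have "\<forall>\<^sub>F s in at 0. \<bar>f s\<bar> \<le> 1 + K * s\<^sup>2 \<and> \<bar>g s\<bar> \<le> 1 + K * s\<^sup>2"
    unfolding K_def by (intro eventually_conj eventually_abs_le_quadratic f_lim g_lim)
  then have "\<forall>\<^sub>F s in at 0. Q (2 * s) \<le> Q s"
  proof eventually_elim
    case (elim s)
    have "\<bar>2 * (f s + g s)\<bar> \<le> 4 * (1 + K * s\<^sup>2)"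
      using elim abs_triangle_ineq[of "f s" "g s"] unfolding abs_mult by simp
    also have "\<dots> \<le> 4 * exp (K * s\<^sup>2)"
      by (intro mult_left_mono exp_ge_add_one_self) simp
    finally have "\<bar>f (2 * s) - g (2 * s)\<bar> \<le> 4 * exp (K * s\<^sup>2) * \<bar>f s - g s\<bar>"
      unfolding diff abs_mult[of _ "f s - g s"] by (rule mult_right_mono) simp
    then have "\<bar>f (2 * s) - g (2 * s)\<bar> * exp (- K * (2 * s)\<^sup>2 / 3)
        \<le> 4 * exp (K * s\<^sup>2) * \<bar>f s - g s\<bar> * exp (- K * (2 * s)\<^sup>2 / 3)"
      by (rule mult_right_mono) simp
    also have "\<dots> = 4 * \<bar>f s - g s\<bar> * (exp (K * s\<^sup>2) * exp (- K * (2 * s)\<^sup>2 / 3))"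
      by simp
    also have "exp (K * s\<^sup>2) * exp (- K * (2 * s)\<^sup>2 / 3) = exp (- K * s\<^sup>2 / 3)"
      by (simp add: exp_add[symmetric] power_mult_distrib)
    finally have "Q (2 * s) \<le> 4 * \<bar>f s - g s\<bar> * exp (- K * s\<^sup>2 / 3) / (2 * s)\<^sup>2"
      unfolding Q_def by (rule divide_right_mono) simp
    then show ?case
      by (simp add: Q_def power_mult_distrib)
  qed
  then obtain d where d: "d > 0" "\<And>s. s \<noteq> 0 \<Longrightarrow> \<bar>s\<bar> < d \<Longrightarrow> Q (2 * s) \<le> Q s"
    by (auto simp: eventually_at dist_real_def)
  have "((\<lambda>s. \<bar>(f s - 1) / s\<^sup>2 - (g s - 1) / s\<^sup>2\<bar> * exp (- K * s\<^sup>2 / 3))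
      \<longlongrightarrow> \<bar>c - c\<bar> * exp (- K * 0\<^sup>2 / 3)) (at 0)"
    by (intro tendsto_intros f_lim g_lim) simp
  then have Q_lim: "(Q \<longlongrightarrow> 0) (at 0)"
    by (simp add: Q_def[abs_def] diff_divide_distrib[symmetric] abs_divide)
  have halves: "(\<lambda>n. s / 2 ^ n) \<longlonglongrightarrow> 0" for s :: real
    using tendsto_mult[OF tendsto_const[of s] LIMSEQ_power_zero[of "1 / 2 :: real"]]
    by (simp add: power_divide)
  have near: "f s = g s" if "s \<noteq> 0" "\<bar>s\<bar> < d" for s
  proof -
    have small: "\<bar>s / 2 ^ n\<bar> < d" for n
    proof -
      have "\<bar>s\<bar> / 2 ^ n \<le> \<bar>s\<bar> / 1"
        by (rule divide_left_mono) auto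
      then show ?thesis using that(2) by (simp add: abs_divide)
    qed
    have "Q s \<le> Q (s / 2 ^ n)" for n
    proof (induction n)
      case (Suc n)
      have "Q (2 * (s / 2 ^ Suc n)) \<le> Q (s / 2 ^ Suc n)"
        using that(1) small[of "Suc n"] by (intro d(2)) auto
      then show ?case using Suc by simp
    qed simp
    moreover have "(\<lambda>n. Q (s / 2 ^ n)) \<longlonglongrightarrow> 0"
      using that(1) halves
      by (intro filterlim_compose[OF Q_lim]) (auto simp: filterlim_at)
    ultimately have "Q s \<le> 0"
      by (intro LIMSEQ_le_const[of _ 0 "Q s"]) auto
    moreover have "Q s \<ge> 0"
      by (simp add: Q_def)
    ultimately have "Q s = 0"
      by linarith
    then show ?thesis
      using that(1) by (simp add: Q_def)
  qed
  have "\<forall>\<^sub>F n in sequentially. \<bar>t / 2 ^ n\<bar> < d"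
    by (rule order_tendstoD(2)[OF tendsto_rabs[OF halves]]) (simp add: d(1))
  then obtain n where "\<bar>t / 2 ^ n\<bar> < d"
    by (auto simp: eventually_sequentially)
  then have "f (t / 2 ^ n) = g (t / 2 ^ n)"
    using near \<open>t \<noteq> 0\<close> by simp
  moreover have "f (2 ^ n * s) = g (2 ^ n * s)" if "f s = g s" for s
    by (induction n) (use that in \<open>simp_all add: f g mult.assoc\<close>)
  ultimately have "f (2 ^ n * (t / 2 ^ n)) = g (2 ^ n * (t / 2 ^ n))"
    by blast
  then show ?thesis by simp
qed

lemma cosh_taylor_2: "((\<lambda>t::real. (cosh t - 1) / t\<^sup>2) \<longlongrightarrow> 1 / 2) (at 0)"
proof -
  have d: "deriv cosh = (sinh :: real \<Rightarrow> real)"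
    by (intro ext DERIV_imp_deriv) (auto intro!: derivative_eq_intros)
  have dd: "(sinh has_real_derivative 1) (at 0)"
    by (auto intro!: derivative_eq_intros)
  have "(cosh has_real_derivative sinh t) (at t)" for t :: real
    by (auto intro!: derivative_eq_intros)
  then have "twice_differentiable_at cosh 0"
    using dd by (auto simp: twice_differentiable_at_def d real_differentiable_def
        intro!: always_eventually)
  from taylor_peano_2[OF this] show ?thesis
    by (simp add: d DERIV_imp_deriv[OF dd])
qed

lemma rcl_dalembert:
  assumes "recognition_composition_law J"
  shows "(1 + J_log J (t + u)) + (1 + J_log J (t - u)) = 2 * (1 + J_log J t) * (1 + J_log J u)"
proof -
  have "J (exp t * exp u) + J (exp t / exp u)
      = 2 * J (exp t) + 2 * J (exp u) + 2 * J (exp t) * J (exp u)"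
    using assms by (simp add: recognition_composition_law_def)
  then show ?thesis
    by (simp add: J_log_def exp_add exp_diff algebra_simps)
qed

text \<open>
  D'Alembert's equation leaves \<open>J 1 = 0\<close> or \<open>J 1 = -1\<close>, and the second value forces \<open>J\<close> to be
  the constant \<open>-1\<close>.
\<close>
lemma rcl_J_log_0:
  assumes "recognition_composition_law J" and "\<not> J constant_on {0<..}"
  shows "J_log J 0 = 0"
proof (rule ccontr)
  assume "J_log J 0 \<noteq> 0"
  moreover have "2 * J_log J 0 * (1 + J_log J 0) = 0"
    using rcl_dalembert[OF assms(1), of 0 0] by (simp add: algebra_simps)
  ultimately have "J_log J 0 = -1"
    by (simp add: add_eq_0_iff)
  then have "J_log J t = -1" for t
    using rcl_dalembert[OF assms(1), of t 0] by simp
  then have "J x = -1" if "x > 0" for x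
    using that by (metis J_log_def exp_ln)
  then have "J constant_on {0<..}"
    by (auto simp: constant_on_def)
  with assms(2) show False by contradiction
qed

theorem theoremA3:
  fixes J :: "real \<Rightarrow> real"
  assumes "continuous_on {0<..} J"
    and "\<not> J constant_on {0<..}"
    and "recognition_composition_law J"
    and "twice_differentiable_at (J_log J) 0"
    and "deriv (deriv (J_log J)) 0 = 1"
  shows "\<forall>x>0. J x = 1 / 2 * (x + inverse x) - 1 \<and>
                1 / 2 * (x + inverse x) - 1 = (x - 1)\<^sup>2 / (2 * x)"
proof -
  let ?H = "\<lambda>t. 1 + J_log J t"
  note dalembert = rcl_dalembert[OF assms(3)]
  have J0: "J_log J 0 = 0"
    using rcl_J_log_0 assms by blast
  have "J_log J (- t) = J_log J t" for t
    using dalembert[of 0 t] by (simp add: J0)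
  moreover have "J_log J differentiable (at 0)"
    using assms(4) eventually_nhds_x_imp_x unfolding twice_differentiable_at_def by blast
  ultimately have "deriv (J_log J) 0 = 0"
    by (rule deriv_even_0[rotated])
  then have H_lim: "((\<lambda>s. (?H s - 1) / s\<^sup>2) \<longlongrightarrow> 1 / 2) (at 0)"
    using taylor_peano_2[OF assms(4)] by (simp add: J0 assms(5))
  have H_double: "?H (2 * s) = 2 * (?H s)\<^sup>2 - 1" for s
    using dalembert[of s s] unfolding mult_2[of s] power2_eq_square diff_self J0 by linarith
  have H_cosh: "?H t = cosh t" for t
  proof (cases "t = 0")
    case False
    then show ?thesis
      by (intro doubling_formula_unique[OF H_double _ H_lim cosh_taylor_2])
        (simp_all add: cosh_double_cosh)
  qed (simp add: J0)
  show ?thesis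
  proof (intro allI impI conjI)
    fix x :: real
    assume "x > 0"
    then show "J x = 1 / 2 * (x + inverse x) - 1"
      using H_cosh[of "ln x"] by (simp add: J_log_def cosh_ln_real field_simps)
    show "1 / 2 * (x + inverse x) - 1 = (x - 1)\<^sup>2 / (2 * x)"
      using \<open>x > 0\<close> by (simp add: field_simps power2_eq_square)
  qed
qed

end
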